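(* Consider the Perfect Integrators $\dot{x}=f_n(t)$, $n\in\mathbb{N}$, and $\dot{x}=f(t)$, where $f_n,f\in C^0(\mathbb{R})$ are periodic with period $1$, $f_n(t)>0$ and $f(t)>0$ for all $t$, $f_n\to f$ in $C^0(\mathbb{R})$, and the rotation numbers $\varrho_n,\varrho$ of the firing maps $\Phi_n,\Phi$ are all irrational. Then the invariant measures $\mu^{(n)}$ and $\mu$ have densities $g_n$ and $g$, respectively, (with respect to Lebesgue measure on $[0,1]$) and $g_n\to g$ in $C^0([0,1])$. If additionally the set $\mathcal{C}_\Psi:=\{t\in[0,1]:\Psi'(t)=0\}=\{t\in[0,1]:\Phi'(t)=1\}$ of critical points of the displacement function $\Psi(t)=\Phi(t)-t$ has Lebesgue measure $0$, then $$\sup\big\{|\mu^{(n)}_{\mathrm{ISI}}(I)-\mu_{\mathrm{ISI}}(I)|:\ I\in\mathcal{J}\big\}\to0\quad\text{as } n\to\infty,$$ where $\mathcal{J}$ is the class of all intervals $I\subset[0,1]$ (open, closed, half-closed) and $\mu^{(n)}_{\mathrm{ISI}}$, $\mu_{\mathrm{ISI}}$ are the interspike-interval distributions for $\Phi_n$ and $\Phi$.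
   Context: The firing map of $\dot{x}=f(t)$ (reset value $0$, threshold $1$) is $\Phi(t):=\inf\{t_*>t:\ 1\le\int_t^{t_*}f(u)\,du\}$. Under the assumptions it is a $C^1$ lift of an orientation preserving circle homeomorphism $\varphi$ (firing phase map) with rotation number $\varrho=\lim_n\Phi^n(t)/n$. When $\varrho$ is irrational, $\mu$ is the unique invariant Borel probability measure of $\varphi$, regarded on $[0,1]$ (with endpoints identified) as an invariant measure of $\Phi\bmod1$, and $\mu_{\mathrm{ISI}}(A):=\mu(\{t\in[0,1]:\Phi(t)-t\in A\})$ for Borel $A\subset\mathbb{R}$. Similarly $\mu^{(n)}$, $\mu^{(n)}_{\mathrm{ISI}}$ for $\Phi_n$. Convergence in $C^0(\mathbb{R})$ is uniform convergence on compact sets. *)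

theory Defs
  imports "HOL-Probability.Probability"
begin

definition firing_map :: "(real \<Rightarrow> real) \<Rightarrow> real \<Rightarrow> real" where
  "firing_map f t = Inf {s. t < s \<and> 1 \<le> integral {t..s} f}"

definition displacement :: "(real \<Rightarrow> real) \<Rightarrow> real \<Rightarrow> real" where
  "displacement \<Phi> t = \<Phi> t - t"

text \<open>The common limit of the orbit averages over all starting points.\<close>

definition rotation_number :: "(real \<Rightarrow> real) \<Rightarrow> real" where
  "rotation_number \<Phi> = (THE \<rho>. \<forall>t. (\<lambda>n. (\<Phi> ^^ n) t / real n) \<longlonglongrightarrow> \<rho>)"

text \<open>
  Borel probability measures on the circle, regarded on \<open>[0,1]\<close> with endpoints identified,
  that are invariant under \<open>\<Phi> mod 1\<close>. Since \<open>frac\<close> takes values in \<open>[0,1)\<close>, invariance forces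
  the point \<open>1\<close> to have measure \<open>0\<close>, so that the mass of the point \<open>0 = 1\<close> of the circle is
  carried by \<open>0\<close> alone and such measures correspond bijectively to the invariant measures of
  the circle map.
\<close>

definition invariant_prob :: "(real \<Rightarrow> real) \<Rightarrow> real measure \<Rightarrow> bool" where
  "invariant_prob \<Phi> M \<longleftrightarrow>
     prob_space M \<and> sets M = sets (restrict_space borel {0..1}) \<and>
     (\<lambda>t. frac (\<Phi> t)) \<in> measurable M M \<and> distr M M (\<lambda>t. frac (\<Phi> t)) = M"

definition invariant_measure :: "(real \<Rightarrow> real) \<Rightarrow> real measure" where
  "invariant_measure \<Phi> = (THE M. invariant_prob \<Phi> M)"

definition isi_distribution :: "(real \<Rightarrow> real) \<Rightarrow> real measure" where
  "isi_distribution \<Phi> = distr (invariant_measure \<Phi>) borel (displacement \<Phi>)"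

definition has_continuous_density :: "real measure \<Rightarrow> (real \<Rightarrow> real) \<Rightarrow> bool" where
  "has_continuous_density M g \<longleftrightarrow>
     continuous_on {0..1} g \<and> (\<forall>t\<in>{0..1}. 0 \<le> g t) \<and>
     M = density (restrict_space lborel {0..1}) (\<lambda>t. ennreal (g t))"

definition critical_set :: "(real \<Rightarrow> real) \<Rightarrow> real set" where
  "critical_set \<Psi> = {t \<in> {0..1}. deriv \<Psi> t = 0}"

definition unit_subintervals :: "real set set" where
  "unit_subintervals = {I. is_interval I \<and> I \<subseteq> {0..1}}"

end

theory Submission
  imports Defs "HOL-Analysis.Kronecker_Approximation_Theorem"
begin

text \<open>
  Let \<open>F\<close> be a primitive of \<open>f\<close> and \<open>q = F 1 - F 0\<close>. Since \<open>F (\<Phi> t) = F t + 1\<close>, the phase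
  \<open>h = F / q\<close> conjugates the firing map to the translation by \<open>1 / q\<close>; so the rotation number is
  \<open>1 / q\<close>, and unique ergodicity of irrational rotations identifies the invariant measure as the
  one with density \<open>h' = f / q\<close>, which depends continuously on \<open>f\<close>.

  For the interspike intervals, \<open>\<Psi>\<^sub>n \<longlonglongrightarrow> \<Psi>\<close> uniformly. If \<open>\<bar>\<Psi>\<^sub>n - \<Psi>\<bar> \<le> \<delta>\<close>, the events \<open>\<Psi>\<^sub>n \<in> I\<close> and
  \<open>\<Psi> \<in> I\<close> differ only where \<open>\<Psi>\<close> is \<open>\<delta>\<close>-close to an endpoint of \<open>I\<close>. Off the critical set the
  level sets of \<open>\<Psi>\<close> are discrete, so the distribution of \<open>\<Psi>\<close> has no atoms, and such
  \<open>\<delta>\<close>-neighbourhoods have uniformly small measure.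
\<close>

subsection \<open>Monotone maps commuting with an irrational translation\<close>

text \<open>Shift \<open>p\<close> and increment \<open>r\<close> are independent so that degree-one
  lifts (\<open>p = r = 1\<close>), periodic functions (\<open>p = 1\<close>, \<open>r = 0\<close>)
  and the irrational translation are all instances.\<close>

lemma translation_int_multiple:
  fixes K :: "real \<Rightarrow> real"
  assumes "\<And>y. K (y + p) = K y + r"
  shows "K (y + of_int j * p) = K y + of_int j * r"
proof (induction j rule: int_induct[where k = 0])
  case (step1 i)
  have "K (y + of_int i * p + p) = K y + of_int i * r + r"
    using assms step1 by simp
  then show ?case by (simp add: algebra_simps)
next
  case (step2 i)
  have "K (y + of_int (i - 1) * p + p) = K (y + of_int (i - 1) * p) + r"
    by (rule assms)
  then show ?case using step2 by (simp add: algebra_simps)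
qed simp

lemma floor_scale:
  fixes e y :: real
  assumes "e > 0"
  shows "of_int \<lfloor>y / e\<rfloor> * e \<le> y" "y < of_int \<lfloor>y / e\<rfloor> * e + e"
proof -
  define j where "j = \<lfloor>y / e\<rfloor>"
  have "of_int j \<le> y / e" "y / e < of_int j + 1"
    unfolding j_def by linarith+
  then show "of_int \<lfloor>y / e\<rfloor> * e \<le> y" "y < of_int \<lfloor>y / e\<rfloor> * e + e"
    using assms unfolding j_def[symmetric]
    by (simp_all add: pos_le_divide_eq pos_divide_less_eq distrib_right)
qed

text \<open>At integer multiples of \<open>e\<close> the map is exactly the shift by
  \<open>K 0\<close>; between two consecutive multiples monotonicity confines it to a band of height
  \<open>e\<close>.\<close>

lemma mono_translation_close:
  fixes K :: "real \<Rightarrow> real"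
  assumes "mono K" "e > 0" and tr: "\<And>y. K (y + e) = K y + e"
  shows "\<bar>K y - y - K 0\<bar> \<le> e"
proof -
  define j where "j = \<lfloor>y / e\<rfloor>"
  have j: "of_int j * e \<le> y" "y \<le> of_int (j + 1) * e"
    using floor_scale[OF assms(2), of y] unfolding j_def by (simp_all add: algebra_simps)
  have "K (0 + of_int j * e) \<le> K y" "K y \<le> K (0 + of_int (j + 1) * e)"
    using j by (auto intro!: monoD[OF assms(1)])
  then show ?thesis
    using j unfolding translation_int_multiple[of K e e, OF tr]
    by (auto simp: abs_le_iff algebra_simps)
qed

text \<open>This is unique ergodicity of irrational rotations, phrased for lifts of distribution
  functions. By Dirichlet approximation \<open>K\<close> commutes with arbitrarily small
  translations, and \<open>mono_translation_close\<close> then forces \<open>K\<close> to be a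
  translation.\<close>

lemma mono_irrational_translation:
  fixes K :: "real \<Rightarrow> real"
  assumes "mono K" and one: "\<And>y. K (y + 1) = K y + 1"
    and tr: "\<And>y. K (y + \<alpha>) = K y + c" and irr: "\<alpha> \<notin> \<rat>"
  shows "K y = y + K 0"
proof -
  have bnd: "\<bar>K y - y - K 0\<bar> \<le> 1" for y
    using mono_translation_close[OF assms(1) _ one] by simp
  \<comment> \<open>After \<open>n\<close> translations by \<open>\<alpha>\<close> the deviation of
    \<open>K\<close> from the identity has drifted by \<open>n * (c - \<alpha>)\<close>, yet it
    stays bounded.\<close>
  have "c = \<alpha>"
  proof (rule ccontr)
    assume "c \<noteq> \<alpha>"
    obtain n :: nat where n: "1 < real n * \<bar>c - \<alpha>\<bar>"
      using \<open>c \<noteq> \<alpha>\<close> ex_less_of_nat_mult[of "\<bar>c - \<alpha>\<bar>" 1] by auto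
    have "K (0 + of_int (int n) * \<alpha>) = K 0 + of_int (int n) * c"
      by (rule translation_int_multiple[of K \<alpha> c, OF tr])
    then have "\<bar>real n * (c - \<alpha>)\<bar> \<le> 1"
      using bnd[of "real n * \<alpha>"] by (simp add: algebra_simps)
    with n show False by (simp add: abs_mult)
  qed
  have "\<bar>K y - y - K 0\<bar> \<le> \<epsilon>" if "\<epsilon> > 0" for \<epsilon>
  proof -
    obtain N :: nat where N: "N > 0" "1 / real N < \<epsilon>"
      using reals_Archimedean[OF \<open>\<epsilon> > 0\<close>] by (metis inverse_eq_divide zero_less_Suc)
    obtain h k where hk: "0 < k" "\<bar>of_int k * \<alpha> - of_int h\<bar> < 1 / N"
      using Dirichlet_approx[OF N(1)] by metis
    \<comment> \<open>A small combination of the two periods \<open>\<alpha>\<close> and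
      \<open>1\<close>; irrationality makes it nonzero.\<close>
    define d where "d = of_int k * \<alpha> - of_int h"
    have "d \<noteq> 0"
    proof
      assume "d = 0"
      then have "\<alpha> = of_int h / of_int k"
        using hk(1) by (simp add: d_def field_simps)
      with irr show False by simp
    qed
    have d: "K (y + d) = K y + d" for y
    proof -
      have "K (y + of_int k * \<alpha> + of_int (- h) * 1) = K y + of_int k * \<alpha> + of_int (- h) * 1"
        unfolding translation_int_multiple[of K 1 1, OF one]
        by (simp add: translation_int_multiple[of K \<alpha> c, OF tr] \<open>c = \<alpha>\<close>)
      then show ?thesis by (simp add: d_def algebra_simps)
    qed
    \<comment> \<open>For negative \<open>d\<close>, the translation by \<open>d\<close> is read
      backwards from the point \<open>y - d\<close>.\<close>
    have "K (y + \<bar>d\<bar>) = K y + \<bar>d\<bar>" for y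
      using d[of y] d[of "y - d"] by (cases "d \<ge> 0") auto
    then have "\<bar>K y - y - K 0\<bar> \<le> \<bar>d\<bar>"
      using mono_translation_close[OF assms(1)] \<open>d \<noteq> 0\<close> by simp
    then show ?thesis using hk N unfolding d_def by linarith
  qed
  then have "\<bar>K y - y - K 0\<bar> \<le> 0"
    by (rule field_le_epsilon) simp
  then show ?thesis by simp
qed

subsection \<open>The phase of a perfect integrator\<close>

locale perfect_integrator =
  fixes f :: "real \<Rightarrow> real"
  assumes cont: "continuous_on UNIV f"
    and periodic: "f (t + 1) = f t"
    and pos: "f t > 0"
begin

text \<open>For either sign of \<open>t\<close> one of the two intervals is empty or a single point
  and contributes \<open>0\<close>, so this is the oriented integral from \<open>0\<close> to
  \<open>t\<close>.\<close>

definition primitive :: "real \<Rightarrow> real" where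
  "primitive t = integral {0..t} f - integral {t..0} f"

definition charge :: real where
  "charge = primitive 1"

definition phase :: "real \<Rightarrow> real" where
  "phase t = primitive t / charge"

abbreviation \<Phi> :: "real \<Rightarrow> real" where
  "\<Phi> \<equiv> firing_map f"

abbreviation \<Psi> :: "real \<Rightarrow> real" where
  "\<Psi> \<equiv> displacement \<Phi>"

lemma cont_on: "continuous_on S f"
  using cont continuous_on_subset by blast

lemma integrable: "f integrable_on {a..b}"
  by (rule integrable_continuous_real[OF cont_on])

lemma primitive_diff:
  assumes "s \<le> t"
  shows "integral {s..t} f = primitive t - primitive s"
proof -
  have split: "integral {a..c} f + integral {c..b} f = integral {a..b} f"
    if "a \<le> c" "c \<le> b" for a b c
    using Henstock_Kurzweil_Integration.integral_combine[OF that integrable] .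
  consider "0 \<le> s" | "s \<le> 0" "0 \<le> t" | "t \<le> 0" by linarith
  then show ?thesis
  proof cases
    case 1
    then show ?thesis using split[of 0 s t] assms
      by (cases "s = 0"; cases "t = 0") (auto simp: primitive_def)
  next
    case 2
    then show ?thesis using split[of s 0 t] assms
      by (cases "s = 0"; cases "t = 0") (auto simp: primitive_def)
  next
    case 3
    then show ?thesis using split[of s t 0] assms
      by (cases "s = 0"; cases "t = 0") (auto simp: primitive_def)
  qed
qed

lemma primitive_0 [simp]: "primitive 0 = 0"
  by (simp add: primitive_def)

text \<open>Integrating from \<open>t - 1\<close> makes \<open>t\<close> an interior point of the
  domain, whatever its sign; near \<open>t\<close> this integral and \<open>primitive\<close> differ
  by a constant.\<close>

lemma primitive_deriv: "(primitive has_real_derivative f t) (at t)"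
proof -
  have "((\<lambda>x. integral {t - 1..x} f) has_real_derivative f t) (at t within {t - 1..t + 1})"
    by (rule integral_has_real_derivative[OF cont_on]) auto
  then have "((\<lambda>x. integral {t - 1..x} f) has_real_derivative f t) (at t)"
    by (subst (asm) at_within_Icc_at) auto
  then have "((\<lambda>x. primitive (t - 1) + integral {t - 1..x} f) has_real_derivative f t) (at t)"
    by (auto intro!: derivative_eq_intros)
  then show ?thesis
  proof (rule DERIV_cong_ev[THEN iffD1, rotated -1, OF _ refl _ refl])
    have "\<forall>\<^sub>F x in nhds t. x > t - 1"
      by (rule order_tendstoD(1)[OF filterlim_ident]) auto
    then show "\<forall>\<^sub>F x in nhds t. primitive (t - 1) + integral {t - 1..x} f = primitive x"
      by eventually_elim (simp add: primitive_diff)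
  qed
qed

lemma primitive_strict_mono: "strict_mono primitive"
proof (rule strict_monoI)
  fix s t :: real assume "s < t"
  then show "primitive s < primitive t"
    by (rule DERIV_pos_imp_increasing) (use primitive_deriv pos in blast)
qed

lemma charge_pos: "charge > 0"
  using strict_monoD[OF primitive_strict_mono, of 0 1] by (simp add: charge_def)

lemma primitive_plus_1: "primitive (t + 1) = primitive t + charge"
proof -
  have "((\<lambda>t. primitive (t + 1) - primitive t) has_real_derivative 0) (at x)" for x
  proof -
    have "((\<lambda>t. primitive (t + 1)) has_real_derivative f (x + 1)) (at x)"
      by (rule DERIV_shift[THEN iffD1, OF primitive_deriv])
    then show ?thesis
      by (auto intro!: derivative_eq_intros primitive_deriv simp: periodic)
  qed
  then have "primitive (t + 1) - primitive t = primitive (0 + 1) - primitive 0"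
    by (intro DERIV_isconst_all) blast
  then show ?thesis by (simp add: charge_def)
qed

section \<open>The phase as a degree-one homeomorphism of the line\<close>

lemma phase_0 [simp]: "phase 0 = 0"
  by (simp add: phase_def)

lemma phase_1 [simp]: "phase 1 = 1"
  using charge_pos by (simp add: phase_def charge_def)

lemma phase_plus_1: "phase (t + 1) = phase t + 1"
  using charge_pos by (simp add: phase_def primitive_plus_1 add_divide_distrib)

lemma phase_deriv: "(phase has_real_derivative f t / charge) (at t)"
  unfolding phase_def[abs_def] by (intro DERIV_cdivide primitive_deriv)

lemma phase_strict_mono: "strict_mono phase"
  using primitive_strict_mono charge_pos
  by (auto simp: strict_mono_def phase_def divide_strict_right_mono)

lemma phase_less_iff: "phase s < phase t \<longleftrightarrow> s < t"
  using phase_strict_mono by (simp add: strict_mono_less)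

lemma phase_le_iff: "phase s \<le> phase t \<longleftrightarrow> s \<le> t"
  using phase_strict_mono by (simp add: strict_mono_less_eq)

lemma phase_isCont: "isCont phase t"
  using phase_deriv DERIV_isCont by blast

lemma phase_of_int [simp]: "phase (of_int k) = of_int k"
  using translation_int_multiple[of phase 1 1 0 k, OF phase_plus_1] by simp

lemma phase_surj: "\<exists>t. phase t = y"
proof -
  have "\<exists>t\<ge>of_int \<lfloor>y\<rfloor>. t \<le> of_int (\<lfloor>y\<rfloor> + 1) \<and> phase t = y"
  proof (rule IVT)
    show "phase (of_int \<lfloor>y\<rfloor>) \<le> y" "y \<le> phase (of_int (\<lfloor>y\<rfloor> + 1))"
      unfolding phase_of_int by linarith+
  qed (simp_all add: phase_isCont)
  then show ?thesis by blast
qed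

lemma phase_bij: "bij phase"
proof (rule bijI)
  show "inj phase"
    using phase_strict_mono by (rule strict_mono_imp_inj_on)
  show "surj phase"
    using phase_surj unfolding surj_def by (blast intro: sym)
qed

lemma phase_close: "\<bar>phase t - t\<bar> \<le> 1"
  using mono_translation_close[of phase 1 t] phase_plus_1 strict_mono_mono[OF phase_strict_mono]
  by simp

lemma phase_eq_iff: "phase s = phase t \<longleftrightarrow> s = t"
  using phase_strict_mono by (simp add: strict_mono_eq)

text \<open>In the phase coordinate the firing condition on \<open>u\<close> reads
  \<open>phase t + 1 / charge \<le> phase u\<close>. Hence the set in \<open>firing_map\<close> is a
  closed ray \<open>{s..}\<close>, and its infimum is the \<open>s\<close> at which equality
  holds.\<close>

lemma phase_firing: "phase (\<Phi> t) = phase t + 1 / charge"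
proof -
  obtain s where s: "phase s = phase t + 1 / charge"
    using phase_surj by blast
  have "t < s"
    using s charge_pos by (subst phase_less_iff[symmetric]) simp
  have "{s. t < s \<and> 1 \<le> integral {t..s} f} = {s..}"
  proof (intro set_eqI iffI)
    fix u assume "u \<in> {s. t < s \<and> 1 \<le> integral {t..s} f}"
    then have "1 \<le> primitive u - primitive t" by (auto simp: primitive_diff)
    then have "phase t + 1 / charge \<le> phase u"
      using charge_pos unfolding phase_def add_divide_distrib[symmetric]
      by (simp add: divide_le_cancel)
    then have "phase s \<le> phase u" by (simp add: s)
    then show "u \<in> {s..}" by (simp add: phase_le_iff)
  next
    fix u assume "u \<in> {s..}"
    then have u: "s \<le> u" by simp
    then have "phase s \<le> phase u" by (simp add: phase_le_iff)
    then have "phase t + 1 / charge \<le> phase u" by (simp add: s)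
    then have "1 \<le> primitive u - primitive t"
      using charge_pos unfolding phase_def add_divide_distrib[symmetric]
      by (simp add: divide_le_cancel)
    then show "u \<in> {s. t < s \<and> 1 \<le> integral {t..s} f}"
      using u \<open>t < s\<close> by (simp add: primitive_diff)
  qed
  then have "\<Phi> t = s" by (simp add: firing_map_def)
  then show ?thesis by (simp add: s)
qed

lemma firing_eq_iff: "\<Phi> t = s \<longleftrightarrow> phase s = phase t + 1 / charge"
  using phase_firing[of t] by (metis phase_eq_iff)

lemma primitive_firing: "primitive (\<Phi> t) = primitive t + 1"
  using phase_firing[of t] charge_pos by (simp add: phase_def field_simps)

lemma firing_le_iff: "\<Phi> s \<le> \<Phi> t \<longleftrightarrow> s \<le> t"
  using phase_le_iff[of "\<Phi> s" "\<Phi> t"] by (simp add: phase_firing phase_le_iff)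

lemma firing_gt: "t < \<Phi> t"
  using charge_pos phase_less_iff[of t "\<Phi> t"] by (simp add: phase_firing)

lemma firing_plus_1: "\<Phi> (t + 1) = \<Phi> t + 1"
  unfolding firing_eq_iff by (simp add: phase_plus_1 phase_firing)

lemma firing_plus_int: "\<Phi> (t + of_int k) = \<Phi> t + of_int k"
  using translation_int_multiple[of \<Phi> 1 1 t k, OF firing_plus_1] by simp

lemma firing_surj: "\<exists>t. \<Phi> t = s"
  using phase_surj[of "phase s - 1 / charge"] by (simp add: firing_eq_iff) (metis diff_add_cancel)

section \<open>Regularity of the inverse phase and of the firing map\<close>

lemma inv_phase: "phase (inv phase y) = y" "inv phase (phase t) = t"
  using phase_bij by (simp_all add: bij_is_surj surj_f_inv_f bij_is_inj)

lemma inv_phase_isCont: "isCont (inv phase) y"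
proof -
  have "isCont (inv phase) (phase (inv phase y))"
    by (rule isCont_inverse_function[where d = 1]) (auto simp: inv_phase phase_isCont)
  then show ?thesis by (simp add: inv_phase)
qed

lemma inv_phase_deriv: "(inv phase has_real_derivative charge / f (inv phase y)) (at y)"
proof -
  have "(inv phase has_real_derivative inverse (f (inv phase y) / charge)) (at y)"
    using pos[of "inv phase y"] charge_pos
    by (intro has_field_derivative_inverse_basic[where f = phase and t = UNIV]
        phase_deriv inv_phase_isCont) (auto simp: inv_phase)
  then show ?thesis by simp
qed

lemma firing_conv: "\<Phi> = (\<lambda>t. inv phase (phase t + 1 / charge))"
  by (auto simp: firing_eq_iff inv_phase)

lemma firing_deriv: "(\<Phi> has_real_derivative f t / f (\<Phi> t)) (at t)"
proof -
  have "((\<lambda>t. inv phase (phase t + 1 / charge)) has_real_derivative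
      charge / f (inv phase (phase t + 1 / charge)) * (f t / charge)) (at t)"
    by (rule DERIV_chain2[OF inv_phase_deriv]) (auto intro!: derivative_eq_intros phase_deriv)
  then show ?thesis
    using charge_pos unfolding firing_conv by simp
qed

lemma firing_isCont: "isCont \<Phi> t"
  using firing_deriv DERIV_isCont by blast

lemma displacement_deriv: "(\<Psi> has_real_derivative f t / f (\<Phi> t) - 1) (at t)"
  unfolding displacement_def[abs_def] by (auto intro!: derivative_eq_intros firing_deriv)

lemma critical_set_eq: "critical_set \<Psi> = {t \<in> {0..1}. deriv \<Phi> t = 1}"
  unfolding critical_set_def
  using DERIV_imp_deriv[OF displacement_deriv] DERIV_imp_deriv[OF firing_deriv] by auto

section \<open>The rotation number\<close>

lemma phase_firing_funpow: "phase ((\<Phi> ^^ n) t) = phase t + n / charge"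
  by (induction n) (simp_all add: phase_firing add_divide_distrib)

lemma rotation_number_eq: "rotation_number \<Phi> = 1 / charge"
proof -
  have lim: "(\<lambda>n. (\<Phi> ^^ n) t / real n) \<longlonglongrightarrow> 1 / charge" for t
  proof -
    \<comment> \<open>The \<open>1\<close> bounds the distance between a point and its phase
      (\<open>phase_close\<close>); the other term is the phase of the starting point.\<close>
    define B where "B = 1 + \<bar>phase t\<bar>"
    have "(\<lambda>n. (\<Phi> ^^ n) t / real n - 1 / charge) \<longlonglongrightarrow> 0"
    proof (rule Lim_null_comparison)
      show "\<forall>\<^sub>F n in sequentially. norm ((\<Phi> ^^ n) t / real n - 1 / charge) \<le> B / real n"
      proof (rule eventually_mono[OF eventually_gt_at_top[of 0]])
        fix n :: nat assume "n > 0"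
        have "\<bar>(\<Phi> ^^ n) t - n / charge\<bar> \<le> B"
          using phase_close[of "(\<Phi> ^^ n) t"] unfolding phase_firing_funpow B_def by linarith
        then have "\<bar>(\<Phi> ^^ n) t - n / charge\<bar> / n \<le> B / n"
          by (rule divide_right_mono) simp
        moreover have "((\<Phi> ^^ n) t - n / charge) / n = (\<Phi> ^^ n) t / real n - 1 / charge"
          using \<open>n > 0\<close> by (simp add: diff_divide_distrib)
        ultimately show "norm ((\<Phi> ^^ n) t / real n - 1 / charge) \<le> B / real n"
          by (metis abs_divide abs_of_nat real_norm_def)
      qed
      show "(\<lambda>n. B / real n) \<longlonglongrightarrow> 0"
        by (rule lim_const_over_n)
    qed
    then show ?thesis by (simp add: LIM_zero_iff)
  qed
  show ?thesis
    unfolding rotation_number_def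
    by (rule the_equality) (use lim LIMSEQ_unique in blast)+
qed

end

subsection \<open>The invariant measure\<close>

text \<open>
  The mean of \<open>\<lfloor>x - t\<rfloor>\<close> is a lift of the distribution function to the whole line: on
  \<open>[0,1)\<close> it is the distribution function minus \<open>1\<close>, and it commutes with integer translations.
  Invariance of \<open>M\<close> becomes a functional equation for this lift that needs no case distinction
  on how arcs wrap around the circle.
\<close>

definition mean_floor :: "real measure \<Rightarrow> real \<Rightarrow> real" where
  "mean_floor M x = (LINT t|M. of_int \<lfloor>x - t\<rfloor>)"

section \<open>Probability measures on the unit interval and their distribution functions\<close>

locale unit_prob = prob_space M for M :: "real measure" +
  assumes sets_unit: "sets M = sets (restrict_space borel {0..1})"
begin

lemma space_unit: "space M = {0..1}"
  using sets_eq_imp_space_eq[OF sets_unit] by (simp add: space_restrict_space)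

lemma borel_measurable_unit:
  "g \<in> borel_measurable borel \<Longrightarrow> g \<in> borel_measurable M"
  by (subst measurable_cong_sets[OF sets_unit refl]) (rule measurable_restrict_space1)

lemma unit_sets_iff: "A \<in> sets M \<longleftrightarrow> A \<in> sets borel \<and> A \<subseteq> {0..1}"
  unfolding sets_unit by (subst sets_restrict_space_iff) auto

lemma floor_integrable:
  fixes g :: "real \<Rightarrow> real"
  assumes [measurable]: "g \<in> borel_measurable borel" and "\<And>t. t \<in> {0..1} \<Longrightarrow> \<bar>g t\<bar> \<le> B"
  shows "integrable M (\<lambda>t. of_int \<lfloor>g t\<rfloor> :: real)"
proof (rule integrable_const_bound[where B = "B + 1"])
  show "AE t in M. norm (of_int \<lfloor>g t\<rfloor> :: real) \<le> B + 1"
  proof (rule AE_I2)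
    fix t assume "t \<in> space M"
    then have "\<bar>g t\<bar> \<le> B" using assms(2) by (simp add: space_unit)
    then show "norm (of_int \<lfloor>g t\<rfloor> :: real) \<le> B + 1"
      unfolding real_norm_def by linarith
  qed
  show "(\<lambda>t. of_int \<lfloor>g t\<rfloor> :: real) \<in> borel_measurable M"
    by (rule borel_measurable_unit) measurable
qed

lemma mean_floor_integrable: "integrable M (\<lambda>t. of_int \<lfloor>x - t\<rfloor> :: real)"
  by (rule floor_integrable[where B = "\<bar>x\<bar> + 1"]) auto

lemma mean_floor_mono: "mono (mean_floor M)"
  unfolding mean_floor_def
  by (intro monoI integral_mono mean_floor_integrable) (simp add: floor_mono)

lemma mean_floor_plus_1: "mean_floor M (x + 1) = mean_floor M x + 1"
proof -
  have "\<lfloor>x + 1 - t\<rfloor> = \<lfloor>x - t\<rfloor> + 1" for t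
    by linarith
  then show ?thesis
    unfolding mean_floor_def using mean_floor_integrable[of x] by (simp add: prob_space)
qed

text \<open>For \<open>t\<close> in the unit interval \<open>x - t\<close> lies in
  \<open>[-1, 1)\<close>, so its floor is \<open>0\<close> if \<open>t \<le> x\<close> and
  \<open>-1\<close> otherwise.\<close>

lemma mean_floor_eq_cdf:
  assumes "0 \<le> x" "x < 1"
  shows "mean_floor M x = prob {0..x} - 1"
proof -
  have A: "{0..x} \<in> events"
    using assms by (auto simp: unit_sets_iff)
  have "mean_floor M x = (LINT t|M. indicator {0..x} t - 1)"
    unfolding mean_floor_def
  proof (rule Bochner_Integration.integral_cong)
    fix t assume "t \<in> space M"
    then have "t \<in> {0..1}" by (simp add: space_unit)
    then have "\<lfloor>x - t\<rfloor> = (if t \<le> x then 0 else -1)"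
      using assms by (auto simp: floor_eq_iff)
    then show "real_of_int \<lfloor>x - t\<rfloor> = indicator {0..x} t - 1"
      using \<open>t \<in> {0..1}\<close> by (auto simp: indicator_def)
  qed simp
  also have "\<dots> = prob {0..x} - 1"
    using A by (subst Bochner_Integration.integral_diff) (auto simp: prob_space less_top[symmetric])
  finally show ?thesis .
qed

lemma cdf_unit: "cdf (distr M borel (\<lambda>t. t)) x = (if x < 0 then 0 else if x < 1 then prob {0..x} else 1)"
proof -
  have "cdf (distr M borel (\<lambda>t. t)) x = measure M ({..x} \<inter> {0..1})"
    unfolding cdf_def by (subst measure_distr) (simp_all add: borel_measurable_unit space_unit)
  moreover have "{..x} \<inter> {0..1} = (if x < 0 then {} else if x < 1 then {0..x} else space M)"
    by (auto simp: space_unit)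
  ultimately show ?thesis by (simp add: prob_space)
qed

end

text \<open>Both measures are pushed to the whole line, where the distribution function determines a
  probability measure. Its values at negative arguments and from \<open>1\<close> on are forced by
  support and total mass.\<close>

lemma unit_prob_eqI:
  assumes "unit_prob M" "unit_prob N"
    and eq: "\<And>x. 0 \<le> x \<Longrightarrow> x < 1 \<Longrightarrow> measure M {0..x} = measure N {0..x}"
  shows "M = N"
proof -
  interpret M: unit_prob M by fact
  interpret N: unit_prob N by fact
  have "real_distribution (distr M borel (\<lambda>t. t))" "real_distribution (distr N borel (\<lambda>t. t))"
    by (auto intro!: M.real_distribution_distr N.real_distribution_distr
        M.borel_measurable_unit N.borel_measurable_unit)
  then have distr: "distr M borel (\<lambda>t. t) = distr N borel (\<lambda>t. t)"
    by (rule cdf_unique) (auto simp: fun_eq_iff M.cdf_unit N.cdf_unit eq)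
  show ?thesis
  proof (rule measure_eqI)
    show "sets M = sets N"
      by (simp add: M.sets_unit N.sets_unit)
    fix A assume "A \<in> sets M"
    then have A: "A \<in> sets borel" "A \<subseteq> {0..1}"
      by (auto simp: M.unit_sets_iff)
    have "emeasure M A = emeasure (distr M borel (\<lambda>t. t)) A"
      using A by (subst emeasure_distr)
        (auto simp: M.borel_measurable_unit M.space_unit Int_absorb2)
    also have "\<dots> = emeasure N A"
      using A unfolding distr by (subst emeasure_distr)
        (auto simp: N.borel_measurable_unit N.space_unit Int_absorb2)
    finally show "emeasure M A = emeasure N A" .
  qed
qed

section \<open>Invariance as a functional equation, and its solution\<close>

context perfect_integrator
begin

lemma firing_borel [measurable]: "\<Phi> \<in> borel_measurable borel"
  by (intro borel_measurable_continuous_onI continuous_at_imp_continuous_on ballI firing_isCont)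

lemma displacement_borel [measurable]: "\<Psi> \<in> borel_measurable borel"
  unfolding displacement_def[abs_def] by measurable

lemma firing_mod_measurable:
  assumes "unit_prob M"
  shows "(\<lambda>t. frac (\<Phi> t)) \<in> measurable M M"
proof -
  interpret unit_prob M by fact
  have "(\<lambda>t. frac (\<Phi> t)) \<in> measurable M (restrict_space borel {0..1})"
  proof (rule measurable_restrict_space2)
    show "(\<lambda>t. frac (\<Phi> t)) \<in> borel_measurable M"
    proof (rule borel_measurable_unit)
      show "(\<lambda>t. frac (\<Phi> t)) \<in> borel_measurable borel"
        unfolding frac_def by measurable
    qed
  qed (auto simp: frac_lt_1 less_imp_le)
  then show ?thesis
    by (subst measurable_cong_sets[OF refl sets_unit])
qed

text \<open>A strictly increasing map commuting with integer translations preserves each comparison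
  \<open>t + k \<le> x\<close> with \<open>k\<close> an integer, and these comparisons determine the
  floor.\<close>

lemma floor_firing_diff: "\<lfloor>\<Phi> x - \<Phi> t\<rfloor> = \<lfloor>x - t\<rfloor>"
proof (rule order.antisym)
  have iff: "k \<le> \<lfloor>\<Phi> x - \<Phi> t\<rfloor> \<longleftrightarrow> k \<le> \<lfloor>x - t\<rfloor>" for k
    using firing_le_iff[of "t + of_int k" x]
    by (simp add: le_floor_iff firing_plus_int le_diff_eq add.commute)
  show "\<lfloor>\<Phi> x - \<Phi> t\<rfloor> \<le> \<lfloor>x - t\<rfloor>"
    using iff[of "\<lfloor>\<Phi> x - \<Phi> t\<rfloor>"] by simp
  show "\<lfloor>x - t\<rfloor> \<le> \<lfloor>\<Phi> x - \<Phi> t\<rfloor>"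
    using iff[of "\<lfloor>x - t\<rfloor>"] by simp
qed

text \<open>The constant is the mean of \<open>\<lfloor>\<Phi> t\<rfloor>\<close>, the integer part
  that \<open>frac\<close> removes; the rest is \<open>floor_firing_diff\<close> under the
  integral.\<close>

lemma mean_floor_firing:
  assumes "unit_prob M"
  obtains c where "\<And>x. mean_floor (distr M M (\<lambda>t. frac (\<Phi> t))) (\<Phi> x) = mean_floor M x + c"
proof -
  interpret unit_prob M by fact
  have bound: "\<bar>\<Phi> t\<bar> \<le> \<bar>\<Phi> 0\<bar> + \<bar>\<Phi> 1\<bar>" if "t \<in> {0..1}" for t
    using that firing_le_iff[of 0 t] firing_le_iff[of t 1] by auto
  have int: "integrable M (\<lambda>t. of_int \<lfloor>\<Phi> t\<rfloor> :: real)"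
    by (rule floor_integrable[OF _ bound]) auto
  have "mean_floor (distr M M (\<lambda>t. frac (\<Phi> t))) (\<Phi> x) =
      mean_floor M x + (LINT t|M. of_int \<lfloor>\<Phi> t\<rfloor>)" for x
  proof -
    have "mean_floor (distr M M (\<lambda>t. frac (\<Phi> t))) (\<Phi> x) =
        (LINT t|M. of_int \<lfloor>\<Phi> x - frac (\<Phi> t)\<rfloor>)"
      unfolding mean_floor_def
      by (rule integral_distr[OF firing_mod_measurable[OF assms]])
        (rule borel_measurable_unit, measurable)
    also have "\<dots> = (LINT t|M. of_int \<lfloor>x - t\<rfloor> + of_int \<lfloor>\<Phi> t\<rfloor>)"
    proof (rule Bochner_Integration.integral_cong[OF refl])
      fix t
      have "\<Phi> x - frac (\<Phi> t) = \<Phi> x - \<Phi> t + of_int \<lfloor>\<Phi> t\<rfloor>"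
        by (simp add: frac_def)
      then have "\<lfloor>\<Phi> x - frac (\<Phi> t)\<rfloor> = \<lfloor>x - t\<rfloor> + \<lfloor>\<Phi> t\<rfloor>"
        by (simp only: floor_add_int[symmetric] floor_firing_diff)
      then show "real_of_int \<lfloor>\<Phi> x - frac (\<Phi> t)\<rfloor> = of_int \<lfloor>x - t\<rfloor> + of_int \<lfloor>\<Phi> t\<rfloor>"
        by simp
    qed
    also have "\<dots> = mean_floor M x + (LINT t|M. of_int \<lfloor>\<Phi> t\<rfloor>)"
      unfolding mean_floor_def using int mean_floor_integrable by simp
    finally show ?thesis .
  qed
  then show ?thesis by (rule that)
qed

text \<open>On \<open>[0,1)\<close> the distribution function is \<open>phase x + c + 1\<close>.
  Nonnegativity at \<open>0\<close> gives \<open>c \<ge> -1\<close>, and the bound by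
  \<open>1\<close> as \<open>x\<close> approaches \<open>1\<close> gives
  \<open>c \<le> -1\<close>.\<close>

lemma cdf_eq_phase:
  assumes "unit_prob M" and eq: "\<And>x. mean_floor M x = phase x + c" and x: "0 \<le> x" "x < 1"
  shows "measure M {0..x} = phase x"
proof -
  interpret unit_prob M by fact
  have prob_eq: "prob {0..x} = phase x + (c + 1)" if "0 \<le> x" "x < 1" for x
    using mean_floor_eq_cdf[OF that] eq[of x] by linarith
  have "c + 1 \<ge> 0"
    using prob_eq[of 0] measure_nonneg[of M "{0..0}"] unfolding phase_0 by linarith
  moreover have "1 \<le> - c + 0"
  proof (rule dense_le_bounded[of 0 1])
    fix y :: real assume y: "0 < y" "y < 1"
    define x where "x = inv phase y"
    have "0 \<le> x" "x < 1"
      using y phase_le_iff[of 0 x] phase_less_iff[of x 1] by (auto simp: x_def inv_phase)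
    then show "y \<le> - c + 0"
      using prob_eq[of x] prob_le_1[of "{0..x}"] inv_phase(1)[of y] unfolding x_def by linarith
  qed simp
  ultimately show ?thesis
    using prob_eq[OF x] by linarith
qed

lemma invariant_cdf:
  assumes inv: "invariant_prob \<Phi> M" and irr: "rotation_number \<Phi> \<notin> \<rat>"
    and x: "0 \<le> x" "x < 1"
  shows "measure M {0..x} = phase x"
proof -
  have M: "unit_prob M" and distr: "distr M M (\<lambda>t. frac (\<Phi> t)) = M"
    using inv by (auto simp: invariant_prob_def unit_prob_def unit_prob_axioms_def)
  interpret unit_prob M by fact
  obtain c where c: "\<And>x. mean_floor M (\<Phi> x) = mean_floor M x + c"
    using mean_floor_firing[OF M] unfolding distr by metis
  \<comment> \<open>The lifted distribution function in the phase coordinate, where the firing map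
    is translation by \<open>1 / charge\<close>; invariance becomes the hypothesis of
    \<open>mono_irrational_translation\<close>.\<close>
  define K where "K y = mean_floor M (inv phase y)" for y
  have "K y = y + K 0" for y
  proof (rule mono_irrational_translation[where \<alpha> = "1 / charge" and c = c])
    show "mono K"
    proof (rule monoI)
      fix x y :: real assume "x \<le> y"
      then have "inv phase x \<le> inv phase y"
        using phase_le_iff[of "inv phase x" "inv phase y"] by (simp add: inv_phase)
      then show "K x \<le> K y"
        unfolding K_def by (rule monoD[OF mean_floor_mono])
    qed
    show "K (y + 1) = K y + 1" for y
    proof -
      have "inv phase (y + 1) = inv phase y + 1"
        by (metis inv_phase phase_plus_1)
      then show ?thesis by (simp add: K_def mean_floor_plus_1)
    qed
    show "K (y + 1 / charge) = K y + c" for y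
    proof -
      have "inv phase (y + 1 / charge) = \<Phi> (inv phase y)"
        by (metis inv_phase phase_firing)
      then show ?thesis by (simp add: K_def c)
    qed
    show "1 / charge \<notin> \<rat>"
      using irr by (simp add: rotation_number_eq)
  qed
  then have "mean_floor M x = phase x + K 0" for x
    using inv_phase(2)[of x] unfolding K_def by metis
  then show ?thesis
    using cdf_eq_phase[OF M _ x] by blast
qed

text \<open>The density is the derivative of \<open>phase\<close>, so that \<open>phase\<close> is
  the distribution function on the unit interval.\<close>

definition phase_measure :: "real measure" where
  "phase_measure = density (restrict_space lborel {0..1}) (\<lambda>t. ennreal (f t / charge))"

lemma f_borel [measurable]: "f \<in> borel_measurable borel"
  using cont by (rule borel_measurable_continuous_onI)

lemma sets_phase_measure: "sets phase_measure = sets (restrict_space borel {0..1})"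
  unfolding phase_measure_def by (simp add: sets_restrict_space)

lemma emeasure_phase_measure:
  assumes "A \<in> sets borel" "A \<subseteq> {0..1}"
  shows "emeasure phase_measure A = (\<integral>\<^sup>+t. ennreal (f t / charge) * indicator A t \<partial>lborel)"
proof -
  have "emeasure phase_measure A =
      (\<integral>\<^sup>+t. ennreal (f t / charge) * indicator A t \<partial>restrict_space lborel {0..1})"
    unfolding phase_measure_def
    by (rule emeasure_density)
      (use assms in \<open>auto intro!: measurable_restrict_space1 simp: sets_restrict_space_iff\<close>)
  also have "\<dots> = (\<integral>\<^sup>+t. ennreal (f t / charge) * indicator A t * indicator {0..1} t \<partial>lborel)"
    by (rule nn_integral_restrict_space) simp
  also have "\<dots> = (\<integral>\<^sup>+t. ennreal (f t / charge) * indicator A t \<partial>lborel)"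
    using assms(2) by (intro nn_integral_cong) (auto simp: indicator_def)
  finally show ?thesis .
qed

lemma density_nonneg: "0 \<le> f t / charge"
  using pos[of t] charge_pos by simp

lemma emeasure_phase_measure_Icc:
  assumes "0 \<le> x" "x \<le> 1"
  shows "emeasure phase_measure {0..x} = ennreal (phase x)"
proof -
  have "emeasure phase_measure {0..x} = (\<integral>\<^sup>+t. ennreal (f t / charge) * indicator {0..x} t \<partial>lborel)"
    using assms by (intro emeasure_phase_measure) auto
  also have "\<dots> = ennreal (phase x - phase 0)"
    using assms density_nonneg
    by (intro nn_integral_FTC_Icc phase_deriv) auto
  finally show ?thesis by simp
qed

lemma phase_measure_unit_prob: "unit_prob phase_measure"
proof -
  have "space phase_measure = {0..1}"
    using sets_eq_imp_space_eq[OF sets_phase_measure] by (simp add: space_restrict_space)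
  then have "prob_space phase_measure"
    using emeasure_phase_measure_Icc[of 1] by (intro prob_spaceI) simp
  then show ?thesis
    by (simp add: unit_prob_def unit_prob_axioms_def sets_phase_measure)
qed

sublocale phase_measure: unit_prob phase_measure
  by (rule phase_measure_unit_prob)

lemma phase_measure_cdf:
  assumes "0 \<le> x" "x \<le> 1"
  shows "measure phase_measure {0..x} = phase x"
proof -
  have "0 \<le> phase x" using assms(1) phase_le_iff[of 0 x] by simp
  then show ?thesis
    using emeasure_phase_measure_Icc[OF assms] by (simp add: measure_def)
qed

lemma mean_floor_phase_measure: "mean_floor phase_measure x = phase x - 1"
proof -
  define r k where "r = frac x" and "k = \<lfloor>x\<rfloor>"
  have x: "x = r + of_int k * 1" and r: "0 \<le> r" "r < 1"
    using frac_lt_1[of x] by (simp_all add: r_def k_def) (simp add: frac_def)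
  have "mean_floor phase_measure x = mean_floor phase_measure r + of_int k * 1"
    unfolding x by (rule translation_int_multiple) (rule phase_measure.mean_floor_plus_1)
  also have "mean_floor phase_measure r = phase r - 1"
    using r by (simp add: phase_measure.mean_floor_eq_cdf phase_measure_cdf)
  also have "phase r - 1 + of_int k * 1 = phase x - 1"
    unfolding x by (subst translation_int_multiple[of phase 1 1]) (auto simp: phase_plus_1)
  finally show ?thesis .
qed

text \<open>Since \<Phi> is onto, the functional equation shows that the lift of the image measure
  is again \<open>phase\<close> plus a constant. Then \<open>cdf_eq_phase\<close> fixes the constant
  and identifies the measure.\<close>

lemma phase_measure_invariant: "invariant_prob \<Phi> phase_measure"
proof -
  let ?\<phi> = "\<lambda>t. frac (\<Phi> t)"
  let ?N = "distr phase_measure phase_measure ?\<phi>"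
  have meas: "?\<phi> \<in> measurable phase_measure phase_measure"
    by (rule firing_mod_measurable[OF phase_measure_unit_prob])
  have N: "unit_prob ?N"
    using phase_measure.prob_space_distr[OF meas]
    by (simp add: unit_prob_def unit_prob_axioms_def sets_phase_measure)
  obtain c where c: "\<And>x. mean_floor ?N (\<Phi> x) = mean_floor phase_measure x + c"
    using mean_floor_firing[OF phase_measure_unit_prob] by metis
  have "mean_floor ?N s = phase s + (c - 1 - 1 / charge)" for s
  proof -
    obtain x where "s = \<Phi> x" using firing_surj by metis
    then show ?thesis using c[of x] by (simp add: mean_floor_phase_measure phase_firing)
  qed
  then have "?N = phase_measure"
    using cdf_eq_phase[OF N] phase_measure_cdf
    by (intro unit_prob_eqI N phase_measure_unit_prob) auto
  then show ?thesis
    using meas phase_measure_unit_prob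
    by (simp add: invariant_prob_def unit_prob_def unit_prob_axioms_def)
qed

lemma invariant_measure_eq:
  assumes "rotation_number \<Phi> \<notin> \<rat>"
  shows "invariant_measure \<Phi> = phase_measure"
  unfolding invariant_measure_def
proof (rule the_equality)
  show "invariant_prob \<Phi> phase_measure" by (rule phase_measure_invariant)
  fix M assume M: "invariant_prob \<Phi> M"
  then have "unit_prob M"
    by (auto simp: invariant_prob_def unit_prob_def unit_prob_axioms_def)
  then show "M = phase_measure"
    using invariant_cdf[OF M assms] phase_measure_cdf
    by (intro unit_prob_eqI phase_measure_unit_prob) auto
qed

lemma phase_measure_density: "has_continuous_density phase_measure (\<lambda>t. f t / charge)"
  unfolding has_continuous_density_def phase_measure_def
  using density_nonneg cont_on by (auto intro!: continuous_intros simp: charge_pos[THEN less_imp_neq, symmetric])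

end

subsection \<open>The distribution of the interspike intervals\<close>

text \<open>Each point has an open neighbourhood meeting \<open>D\<close> in that point alone; by
  Lindelof countably many of these neighbourhoods cover \<open>D\<close>.\<close>

lemma countable_isolated:
  fixes D :: "'a::second_countable_topology set"
  assumes "\<And>x. x \<in> D \<Longrightarrow> \<not> x islimpt D"
  shows "countable D"
proof -
  have "\<exists>T. open T \<and> T \<inter> D = {x}" if "x \<in> D" for x
    using assms[OF that] that unfolding islimpt_def by blast
  then obtain T where T: "\<And>x. x \<in> D \<Longrightarrow> open (T x)" "\<And>x. x \<in> D \<Longrightarrow> T x \<inter> D = {x}"
    by metis
  have "\<And>U. U \<in> T ` D \<Longrightarrow> open U"
    using T(1) by auto
  then obtain F where F: "F \<subseteq> T ` D" "countable F" "\<Union>F = \<Union>(T ` D)"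
    by (rule Lindelof)
  have "D \<subseteq> (\<Union>U\<in>F. U \<inter> D)"
  proof
    fix x assume "x \<in> D"
    then have "x \<in> \<Union>(T ` D)" using T(2)[of x] by blast
    then show "x \<in> (\<Union>U\<in>F. U \<inter> D)"
      using \<open>x \<in> D\<close> unfolding F(3)[symmetric] by blast
  qed
  moreover have "countable (\<Union>U\<in>F. U \<inter> D)"
  proof (rule countable_UN[OF F(2)])
    fix U assume "U \<in> F"
    then obtain x where "x \<in> D" "U = T x" using F(1) by blast
    then show "countable (U \<inter> D)" using T(2) by simp
  qed
  ultimately show ?thesis by (rule countable_subset)
qed

text \<open>The difference quotient vanishes at other points of the level set, but near
  \<open>x\<close> it is close to \<open>d\<close> and hence nonzero.\<close>

lemma not_islimpt_level_set:
  fixes h :: "real \<Rightarrow> real"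
  assumes "(h has_real_derivative d) (at x)" "d \<noteq> 0"
  shows "\<not> x islimpt {t. h t = h x}"
proof
  assume lim: "x islimpt {t. h t = h x}"
  have "((\<lambda>t. (h t - h x) / (t - x)) \<longlongrightarrow> d) (at x)"
    using assms(1) by (simp add: has_field_derivative_iff)
  then have "\<forall>\<^sub>F t in at x. (h t - h x) / (t - x) \<noteq> 0"
    using assms(2) by (rule tendsto_imp_eventually_ne)
  then have "\<forall>\<^sub>F t in at x. t \<notin> {t. h t = h x}"
    by eventually_elim auto
  with lim show False
    by (simp add: islimpt_iff_eventually)
qed

text \<open>If just one of \<open>u\<close>, \<open>v\<close> belongs to \<open>I\<close>, an
  endpoint of \<open>I\<close> lies weakly between them, hence within
  \<open>\<bar>u - v\<bar>\<close> of \<open>v\<close>.\<close>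

lemma interval_mismatch_subset:
  fixes I :: "real set"
  assumes I: "is_interval I" "I \<noteq> {}" "bounded I" and "\<bar>u - v\<bar> \<le> \<delta>" and "u \<in> I \<longleftrightarrow> v \<notin> I"
  shows "\<bar>v - Inf I\<bar> \<le> \<delta> \<or> \<bar>v - Sup I\<bar> \<le> \<delta>"
proof -
  have bdd: "bdd_below I" "bdd_above I"
    using I(3) by (auto simp: bounded_imp_bdd_below bounded_imp_bdd_above)
  have inside: "Inf I \<le> w" "w \<le> Sup I" if "w \<in> I" for w
    using that bdd by (auto intro: cInf_lower cSup_upper)
  have outside: "w \<le> Inf I \<or> Sup I \<le> w" if "w \<notin> I" for w
  proof (rule ccontr)
    assume "\<not> (w \<le> Inf I \<or> Sup I \<le> w)"
    then obtain a b where "a \<in> I" "a < w" "b \<in> I" "w < b"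
      using I(2) bdd by (auto simp: not_le cInf_less_iff less_cSup_iff)
    then have "w \<in> I"
      using I(1) unfolding is_interval_1 by (meson less_imp_le)
    with that show False by blast
  qed
  show ?thesis
    using inside[of u] inside[of v] outside[of u] outside[of v] assms(4,5) by (cases "u \<in> I") auto
qed

section \<open>Absence of atoms and uniform concentration bounds for the displacement\<close>

context perfect_integrator
begin

text \<open>The real-valued form of \<open>emeasure_phase_measure\<close>, in which the measures of
  two integrators can be subtracted under one integral.\<close>

lemma
  assumes "A \<in> sets borel" "A \<subseteq> {0..1}"
  shows density_integrable: "integrable lborel (\<lambda>t. f t / charge * indicator A t)"
    and measure_phase_measure:
      "measure phase_measure A = (LINT t|lborel. f t / charge * indicator A t)"
proof -
  have meas: "(\<lambda>t. f t / charge * indicator A t) \<in> borel_measurable lborel"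
    using assms(1) by measurable
  have eq: "(\<integral>\<^sup>+t. ennreal (f t / charge * indicator A t) \<partial>lborel) = emeasure phase_measure A"
    unfolding emeasure_phase_measure[OF assms]
    by (intro nn_integral_cong) (auto simp: indicator_def)
  have nonneg: "0 \<le> f t / charge * indicator A t" for t
    using density_nonneg[of t] by (intro mult_nonneg_nonneg) auto
  have fin: "emeasure phase_measure A < \<infinity>"
    by (simp add: less_top[symmetric])
  show "integrable lborel (\<lambda>t. f t / charge * indicator A t)"
    by (rule integrableI_nonneg[OF meas AE_I2]) (unfold eq, rule nonneg, rule fin)
  have "(LINT t|lborel. f t / charge * indicator A t) =
      enn2real (\<integral>\<^sup>+t. ennreal (f t / charge * indicator A t) \<partial>lborel)"
    by (rule integral_eq_nn_integral[OF meas AE_I2]) (rule nonneg)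
  then show "measure phase_measure A = (LINT t|lborel. f t / charge * indicator A t)"
    unfolding eq measure_def by simp
qed

lemma primitive_lower:
  assumes "\<And>x. m \<le> f x" "s \<le> t"
  shows "m * (t - s) \<le> primitive t - primitive s"
proof -
  have "integral {s..t} (\<lambda>x. m) \<le> integral {s..t} f"
    using assms by (intro integral_le integrable) auto
  then show ?thesis
    using assms by (simp add: primitive_diff[symmetric] mult.commute)
qed

lemma f_frac: "f (frac x) = f x"
proof -
  define r k where "r = frac x" and "k = \<lfloor>x\<rfloor>"
  have "f x = f (r + of_int k * 1)"
    by (simp add: r_def k_def frac_def)
  also have "\<dots> = f r + of_int k * 0"
    by (rule translation_int_multiple) (simp add: periodic)
  finally show ?thesis by (simp add: r_def)
qed

lemma exists_lower_bound: "\<exists>m>0. \<forall>x. m \<le> f x"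
proof -
  obtain z where z: "\<forall>y\<in>{0..1}. f z \<le> f y"
    using continuous_attains_inf[OF _ _ cont_on, of "{0..1}"] by auto
  have "f z \<le> f x" for x
    using z[rule_format, of "frac x"] frac_lt_1[of x] by (simp add: f_frac)
  then show ?thesis using pos[of z] by blast
qed

text \<open>Noncritical points of a level set are isolated in it, hence countably many; the critical
  ones are null by assumption. The measure has a Lebesgue density, so it does not charge the level
  set.\<close>

lemma level_set_null:
  assumes "critical_set \<Psi> \<in> null_sets lebesgue"
  shows "measure phase_measure {t \<in> {0..1}. \<Psi> t = y} = 0"
proof -
  define L where "L = {t \<in> {0..1}. \<Psi> t = y}"
  have L: "L \<in> sets borel" "L \<subseteq> {0..1}"
    unfolding L_def by auto
  have "countable (L - critical_set \<Psi>)"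
  proof (rule countable_isolated)
    fix x assume x: "x \<in> L - critical_set \<Psi>"
    then have "f x / f (\<Phi> x) - 1 \<noteq> 0"
      using DERIV_imp_deriv[OF displacement_deriv[of x]] by (auto simp: L_def critical_set_def)
    then have "\<not> x islimpt {t. \<Psi> t = \<Psi> x}"
      by (rule not_islimpt_level_set[OF displacement_deriv])
    moreover have "L - critical_set \<Psi> \<subseteq> {t. \<Psi> t = \<Psi> x}"
      using x by (auto simp: L_def)
    ultimately show "\<not> x islimpt (L - critical_set \<Psi>)"
      using islimpt_subset by blast
  qed
  then have "L - critical_set \<Psi> \<in> null_sets lebesgue"
    by (intro null_sets_completionI countable_imp_null_set_lborel)
  then have "(L - critical_set \<Psi>) \<union> critical_set \<Psi> \<in> null_sets lebesgue"
    using assms by (rule null_sets.Un)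
  then have "L \<in> null_sets lebesgue"
    by (rule null_sets_subset) (use L in auto)
  \<comment> \<open>The critical set was handled in the completed measure; \<open>L\<close> itself
    is Borel, so nullity returns to \<open>lborel\<close>.\<close>
  then have null: "L \<in> null_sets lborel"
    using L by (simp add: null_sets_completion_iff)
  have "AE t in lborel. f t / charge * indicator L t = 0"
    using AE_not_in[OF null] by eventually_elim simp
  then have "(LINT t|lborel. f t / charge * indicator L t) = 0"
    by (rule integral_eq_zero_AE)
  then show ?thesis
    using measure_phase_measure[OF L] by (simp add: L_def)
qed

lemma measure_isi:
  assumes "rotation_number \<Phi> \<notin> \<rat>" "A \<in> sets borel"
  shows "measure (isi_distribution \<Phi>) A = measure phase_measure {t \<in> {0..1}. \<Psi> t \<in> A}"
proof -
  have "measure (isi_distribution \<Phi>) A = measure phase_measure (\<Psi> -` A \<inter> space phase_measure)"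
    unfolding isi_distribution_def invariant_measure_eq[OF assms(1)]
    by (rule measure_distr) (use assms(2) in \<open>auto intro: phase_measure.borel_measurable_unit\<close>)
  also have "\<Psi> -` A \<inter> space phase_measure = {t \<in> {0..1}. \<Psi> t \<in> A}"
    by (auto simp: phase_measure.space_unit)
  finally show ?thesis .
qed

lemma isi_real_distribution:
  assumes "rotation_number \<Phi> \<notin> \<rat>"
  shows "real_distribution (isi_distribution \<Phi>)"
  unfolding isi_distribution_def invariant_measure_eq[OF assms]
  by (intro phase_measure.real_distribution_distr phase_measure.borel_measurable_unit displacement_borel)

text \<open>Without atoms the distribution function of the intervals is continuous, hence uniformly
  continuous on a compact interval, and its increments over short intervals are uniformly
  small.\<close>

lemma displacement_concentration:
  assumes irr: "rotation_number \<Phi> \<notin> \<rat>" and crit: "critical_set \<Psi> \<in> null_sets lebesgue"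
    and "\<epsilon> > 0"
  obtains \<delta> where "\<delta> > 0"
    "\<And>y. y \<in> {0..1} \<Longrightarrow> measure phase_measure {t \<in> {0..1}. \<bar>\<Psi> t - y\<bar> \<le> \<delta>} < \<epsilon>"
proof -
  interpret isi: real_distribution "isi_distribution \<Phi>"
    by (rule isi_real_distribution[OF irr])
  have "isCont (cdf (isi_distribution \<Phi>)) x" for x
    using level_set_null[OF crit, of x] measure_isi[OF irr, of "{x}"]
    by (simp add: isi.isCont_cdf)
  then have "continuous_on {- 1..2} (cdf (isi_distribution \<Phi>))"
    by (simp add: continuous_at_imp_continuous_on)
  then have "uniformly_continuous_on {- 1..2} (cdf (isi_distribution \<Phi>))"
    by (rule compact_uniformly_continuous) simp
  then obtain d where d: "d > 0" "\<And>x x'. x \<in> {- 1..2} \<Longrightarrow> x' \<in> {- 1..2} \<Longrightarrow> dist x' x < d \<Longrightarrow>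
      dist (cdf (isi_distribution \<Phi>) x') (cdf (isi_distribution \<Phi>) x) < \<epsilon>"
    unfolding uniformly_continuous_on_def using \<open>\<epsilon> > 0\<close> by metis
  \<comment> \<open>The interval used below has length \<open>3 * \<delta>\<close>, which must be
    less than \<open>d\<close>; the bound \<open>1 / 2\<close> keeps its endpoints inside
    \<open>{- 1..2}\<close>.\<close>
  define \<delta> where "\<delta> = min (d / 4) (1 / 2)"
  have \<delta>: "\<delta> > 0" "3 * \<delta> < d" "\<delta> \<le> 1 / 2"
    using d(1) by (auto simp: \<delta>_def)
  have "measure phase_measure {t \<in> {0..1}. \<bar>\<Psi> t - y\<bar> \<le> \<delta>} < \<epsilon>" if y: "y \<in> {0..1}" for y
  proof -
    have "{t \<in> {0..1}. \<bar>\<Psi> t - y\<bar> \<le> \<delta>} = {t \<in> {0..1}. \<Psi> t \<in> {y - \<delta>..y + \<delta>}}"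
      by (auto simp: abs_le_iff)
    then have "measure phase_measure {t \<in> {0..1}. \<bar>\<Psi> t - y\<bar> \<le> \<delta>} =
        measure (isi_distribution \<Phi>) {y - \<delta>..y + \<delta>}"
      by (simp add: measure_isi[OF irr])
    \<comment> \<open>Differences of the distribution function measure intervals open on the left,
      so the left end is moved out by a further \<open>\<delta>\<close>.\<close>
    also have "\<dots> \<le> measure (isi_distribution \<Phi>) {y - 2 * \<delta><..y + \<delta>}"
      using \<delta>(1) by (intro isi.finite_measure_mono) auto
    also have "\<dots> = cdf (isi_distribution \<Phi>) (y + \<delta>) - cdf (isi_distribution \<Phi>) (y - 2 * \<delta>)"
      using \<delta>(1) by (intro isi.cdf_diff_eq[symmetric]) auto
    also have "\<dots> < \<epsilon>"
      using d(2)[of "y - 2 * \<delta>" "y + \<delta>"] y \<delta> by (auto simp: dist_real_def)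
    finally show ?thesis .
  qed
  with \<delta>(1) show ?thesis by (rule that)
qed

end

subsection \<open>Dependence on the input\<close>

text \<open>The pointwise bound on the densities is integrated over a subset of an interval of
  length \<open>1\<close>, giving one bound for all \<open>A\<close>.\<close>

lemma phase_measure_close:
  assumes "perfect_integrator f\<^sub>1" "perfect_integrator f\<^sub>2"
    and close: "\<And>t. t \<in> {0..1} \<Longrightarrow>
      \<bar>f\<^sub>1 t / perfect_integrator.charge f\<^sub>1 - f\<^sub>2 t / perfect_integrator.charge f\<^sub>2\<bar> \<le> \<epsilon>"
    and A: "A \<in> sets borel" "A \<subseteq> {0..1}"
  shows "\<bar>measure (perfect_integrator.phase_measure f\<^sub>1) A -
    measure (perfect_integrator.phase_measure f\<^sub>2) A\<bar> \<le> \<epsilon>"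
proof -
  interpret F: perfect_integrator f\<^sub>1 by fact
  interpret G: perfect_integrator f\<^sub>2 by fact
  let ?f = "\<lambda>t. f\<^sub>1 t / F.charge * indicator A t" and ?g = "\<lambda>t. f\<^sub>2 t / G.charge * indicator A t"
  have int: "integrable lborel ?f" "integrable lborel ?g"
    by (rule F.density_integrable[OF A], rule G.density_integrable[OF A])
  have "measure F.phase_measure A - measure G.phase_measure A = (LINT t|lborel. ?f t - ?g t)"
    using int by (simp add: F.measure_phase_measure[OF A] G.measure_phase_measure[OF A])
  moreover have "norm (LINT t|lborel. ?f t - ?g t) \<le> (LINT t|lborel. \<epsilon> * indicator {0..1::real} t)"
  proof (rule Bochner_Integration.integral_norm_bound_integral)
    show "integrable lborel (\<lambda>t. ?f t - ?g t)"
      using int by (rule Bochner_Integration.integrable_diff)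
    show "integrable lborel (\<lambda>t. \<epsilon> * indicator {0..1::real} t)"
      by (intro integrable_mult_right integrable_real_indicator) auto
    have "0 \<le> \<epsilon>" using close[of 0] by force
    then show "norm (?f t - ?g t) \<le> \<epsilon> * indicator {0..1} t" for t
      using close[of t] A(2) by (auto simp: indicator_def)
  qed
  ultimately show ?thesis by simp
qed

text \<open>The first integrator fires within time \<open>1 / m\<close>, so the two integrals up to
  that time differ by at most \<open>m * \<delta>\<close>. Since \<open>f\<^sub>2\<close> is at
  least \<open>m\<close>, this gap in charge costs at most \<open>\<delta>\<close> in time: one
  factor \<open>m\<close> pays for the length of the window, the other for the slope.\<close>

lemma firing_map_close:
  assumes "perfect_integrator f\<^sub>1" "perfect_integrator f\<^sub>2"
    and m: "m > 0" "\<And>x. m \<le> f\<^sub>1 x" "\<And>x. m \<le> f\<^sub>2 x" and close: "\<And>x. \<bar>f\<^sub>1 x - f\<^sub>2 x\<bar> \<le> m\<^sup>2 * \<delta>"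
  shows "\<bar>firing_map f\<^sub>1 t - firing_map f\<^sub>2 t\<bar> \<le> \<delta>"
proof -
  interpret F: perfect_integrator f\<^sub>1 by fact
  interpret G: perfect_integrator f\<^sub>2 by fact
  define u v where "u = firing_map f\<^sub>1 t" and "v = firing_map f\<^sub>2 t"
  have tu: "t \<le> u" using F.firing_gt[of t] by (simp add: u_def)
  have "0 \<le> m\<^sup>2 * \<delta>" using close[of 0] by linarith
  then have "0 \<le> \<delta>" using m(1) by (simp add: zero_le_mult_iff)
  have mu: "m * (u - t) \<le> 1"
    using F.primitive_lower[OF m(2) tu] F.primitive_firing[of t] by (simp add: u_def)
  have "integral {t..u} f\<^sub>2 - integral {t..u} f\<^sub>1 = integral {t..u} (\<lambda>x. f\<^sub>2 x - f\<^sub>1 x)"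
    by (rule Henstock_Kurzweil_Integration.integral_diff[symmetric, OF G.integrable F.integrable])
  moreover have "norm (integral {t..u} (\<lambda>x. f\<^sub>2 x - f\<^sub>1 x)) \<le> m\<^sup>2 * \<delta> * (u - t)"
    using close tu F.cont_on G.cont_on
    by (intro integral_bound continuous_on_diff) (auto simp: abs_minus_commute)
  \<comment> \<open>Both \<open>f\<^sub>1\<close> up to \<open>u\<close> and
    \<open>f\<^sub>2\<close> up to \<open>v\<close> collect exactly \<open>1\<close> from time
    \<open>t\<close>, so the difference of the two integrals up to \<open>u\<close> equals the
    charge of \<open>f\<^sub>2\<close> between \<open>v\<close> and \<open>u\<close>.\<close>
  ultimately have "\<bar>G.primitive u - G.primitive v\<bar> \<le> m\<^sup>2 * \<delta> * (u - t)"
    using F.primitive_firing[of t] G.primitive_firing[of t]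
    unfolding F.primitive_diff[OF tu] G.primitive_diff[OF tu] u_def[symmetric] v_def[symmetric] real_norm_def
    by linarith
  also have "\<dots> = m * \<delta> * (m * (u - t))"
    by (simp add: power2_eq_square)
  also have "\<dots> \<le> m * \<delta> * 1"
    using mu m(1) \<open>0 \<le> \<delta>\<close> by (intro mult_left_mono) auto
  finally have "\<bar>G.primitive u - G.primitive v\<bar> \<le> m * \<delta>" by simp
  moreover have "m * \<bar>u - v\<bar> \<le> \<bar>G.primitive u - G.primitive v\<bar>"
    using G.primitive_lower[OF m(3), of u v] G.primitive_lower[OF m(3), of v u]
    by (cases "u \<le> v") auto
  ultimately have "m * \<bar>u - v\<bar> \<le> m * \<delta>" by linarith
  then show ?thesis using m(1) by (simp add: u_def v_def)
qed

text \<open>The change splits in two. Changing the measure on a fixed event costs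
  \<open>\<epsilon>\<close>; changing the displacement under the fixed second measure affects only
  the strips around the two endpoints of \<open>I\<close>, each of measure at most
  \<open>\<eta>\<close>.\<close>

lemma isi_close:
  assumes "perfect_integrator f\<^sub>1" "perfect_integrator f\<^sub>2"
    and irr: "rotation_number (firing_map f\<^sub>1) \<notin> \<rat>" "rotation_number (firing_map f\<^sub>2) \<notin> \<rat>"
    and dens: "\<And>t. t \<in> {0..1} \<Longrightarrow>
      \<bar>f\<^sub>1 t / perfect_integrator.charge f\<^sub>1 - f\<^sub>2 t / perfect_integrator.charge f\<^sub>2\<bar> \<le> \<epsilon>"
    and fire: "\<And>t. t \<in> {0..1} \<Longrightarrow> \<bar>firing_map f\<^sub>1 t - firing_map f\<^sub>2 t\<bar> \<le> \<delta>"
    and conc: "\<And>y. y \<in> {0..1} \<Longrightarrow> measure (perfect_integrator.phase_measure f\<^sub>2)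
      {t \<in> {0..1}. \<bar>displacement (firing_map f\<^sub>2) t - y\<bar> \<le> \<delta>} \<le> \<eta>"
    and I: "I \<in> unit_subintervals"
  shows "\<bar>measure (isi_distribution (firing_map f\<^sub>1)) I -
    measure (isi_distribution (firing_map f\<^sub>2)) I\<bar> \<le> \<epsilon> + 2 * \<eta>"
proof -
  interpret F: perfect_integrator f\<^sub>1 by fact
  interpret G: perfect_integrator f\<^sub>2 by fact
  have "0 \<le> \<epsilon>" using dens[of 0] by force
  have "0 \<le> \<eta>" using order.trans[OF measure_nonneg conc[of 0]] by simp
  show ?thesis
  proof (cases "I = {}")
    case True
    then show ?thesis using \<open>0 \<le> \<epsilon>\<close> \<open>0 \<le> \<eta>\<close> by simp
  next
    case False
    have int: "is_interval I" and sub: "I \<subseteq> {0..1}"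
      using I by (auto simp: unit_subintervals_def)
    have bdd: "bounded I" using sub bounded_closed_interval bounded_subset by blast
    have [measurable]: "I \<in> sets borel" by (rule real_interval_borel_measurable[OF int])
    define S where "S y = {t \<in> {0..1}. \<bar>G.\<Psi> t - y\<bar> \<le> \<delta>}" for y
    define A B where "A = {t \<in> {0..1}. F.\<Psi> t \<in> I}" and "B = {t \<in> {0..1}. G.\<Psi> t \<in> I}"
    have [measurable]: "A \<in> sets borel" "B \<in> sets borel" "S y \<in> sets borel" for y
      unfolding A_def B_def S_def by measurable
    have sets: "A \<in> sets G.phase_measure" "B \<in> sets G.phase_measure" "S y \<in> sets G.phase_measure" for y
      unfolding G.phase_measure.unit_sets_iff by (auto simp: A_def B_def S_def)
    \<comment> \<open>The strip bound \<open>conc\<close> is available only for levels in the unit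
      interval.\<close>
    have ends: "Inf I \<in> {0..1}" "Sup I \<in> {0..1}"
      using closed_subset_contains_Inf[of "{0..1}" I] closed_subset_contains_Sup[of "{0..1}" I]
        False sub bdd by (auto simp: bounded_imp_bdd_below bounded_imp_bdd_above)
    let ?\<mu> = "measure G.phase_measure"
    have mismatch: "t \<in> S (Inf I) \<union> S (Sup I)" if "t \<in> {0..1}" "t \<in> A \<longleftrightarrow> t \<notin> B" for t
    proof -
      have "\<bar>G.\<Psi> t - Inf I\<bar> \<le> \<delta> \<or> \<bar>G.\<Psi> t - Sup I\<bar> \<le> \<delta>"
        by (rule interval_mismatch_subset[OF int False bdd, where u = "F.\<Psi> t"])
          (use that fire[of t] in \<open>auto simp: A_def B_def displacement_def\<close>)
      then show ?thesis using that by (auto simp: S_def)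
    qed
    have S: "?\<mu> (S (Inf I) \<union> S (Sup I)) \<le> 2 * \<eta>"
      using measure_Un_le[OF sets(3) sets(3), of "Inf I" "Sup I"]
        conc[OF ends(1)] conc[OF ends(2)] unfolding S_def by linarith
    have "?\<mu> A \<le> ?\<mu> (B \<union> (S (Inf I) \<union> S (Sup I)))"
      using mismatch sets
      by (intro G.phase_measure.finite_measure_mono sets.Un) (auto simp: A_def)
    then have "?\<mu> A \<le> ?\<mu> B + 2 * \<eta>"
      using measure_Un_le[OF sets(2) sets.Un[OF sets(3) sets(3)],
          of "Inf I" "Sup I"] S by linarith
    moreover have "?\<mu> B \<le> ?\<mu> (A \<union> (S (Inf I) \<union> S (Sup I)))"
      using mismatch sets
      by (intro G.phase_measure.finite_measure_mono sets.Un) (auto simp: B_def)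
    then have "?\<mu> B \<le> ?\<mu> A + 2 * \<eta>"
      using measure_Un_le[OF sets(1) sets.Un[OF sets(3) sets(3)],
          of "Inf I" "Sup I"] S by linarith
    moreover have "\<bar>measure F.phase_measure A - ?\<mu> A\<bar> \<le> \<epsilon>"
      by (rule phase_measure_close[OF assms(1,2) dens]) (auto simp: A_def)
    ultimately show ?thesis
      unfolding F.measure_isi[OF irr(1) \<open>I \<in> sets borel\<close>] G.measure_isi[OF irr(2) \<open>I \<in> sets borel\<close>]
        A_def[symmetric] B_def[symmetric]
      by linarith
  qed
qed

text \<open>The charges are integrals over one period, so they converge under uniform convergence;
  the limit charge is positive, which permits division.\<close>

lemma density_uniform_limit:
  assumes fs: "\<And>n. perfect_integrator (fs n)" and f: "perfect_integrator f"
    and lim: "uniform_limit {0..1} fs f sequentially"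
  shows "uniform_limit {0..1} (\<lambda>n t. fs n t / perfect_integrator.charge (fs n))
    (\<lambda>t. f t / perfect_integrator.charge f) sequentially"
proof -
  interpret f: perfect_integrator f by fact
  have cont: "continuous_on {0..1} (fs n)" for n
    by (rule perfect_integrator.cont_on[OF fs])
  obtain J L where J: "\<And>n. (fs n has_integral J n) {0..1}" "(f has_integral L) {0..1}" "J \<longlonglongrightarrow> L"
    by (rule uniform_limit_integral[OF lim cont]) auto
  have charge: "perfect_integrator.charge h = integral {0..1} h" if "perfect_integrator h" for h
    using perfect_integrator.primitive_diff[OF that, of 0 1]
    by (simp add: perfect_integrator.charge_def[OF that] perfect_integrator.primitive_0[OF that])
  have "(\<lambda>n. perfect_integrator.charge (fs n)) \<longlonglongrightarrow> f.charge"
    using J(3) by (simp add: charge fs f integral_unique[OF J(1)] integral_unique[OF J(2)])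
  then have "uniform_limit {0..1} (\<lambda>n (t::real). perfect_integrator.charge (fs n)) (\<lambda>t. f.charge) sequentially"
    by (simp add: uniform_limit_iff tendsto_iff)
  moreover have "bounded (f ` {0..1})"
    by (intro compact_imp_bounded compact_continuous_image f.cont_on) simp
  ultimately show ?thesis
    using f.charge_pos by (intro uniform_lim_divide[OF lim, where b = f.charge]) auto
qed

section \<open>Convergence of the densities and of the interspike-interval probabilities\<close>

theorem proposition3p17:
  fixes fs :: "nat \<Rightarrow> real \<Rightarrow> real" and f :: "real \<Rightarrow> real"
  assumes "\<And>n. continuous_on UNIV (fs n)" and "continuous_on UNIV f"
    and "\<And>n t. fs n (t + 1) = fs n t" and "\<And>t. f (t + 1) = f t"
    and "\<And>n t. fs n t > 0" and "\<And>t. f t > 0"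
    and "\<And>K. compact K \<Longrightarrow> uniform_limit K fs f sequentially"
    and "\<And>n. rotation_number (firing_map (fs n)) \<notin> \<rat>"
    and "rotation_number (firing_map f) \<notin> \<rat>"
  shows "(\<exists>gs g.
            (\<forall>n. has_continuous_density (invariant_measure (firing_map (fs n))) (gs n)) \<and>
            has_continuous_density (invariant_measure (firing_map f)) g \<and>
            uniform_limit {0..1} gs g sequentially) \<and>
         critical_set (displacement (firing_map f)) = {t \<in> {0..1}. deriv (firing_map f) t = 1} \<and>
         (critical_set (displacement (firing_map f)) \<in> null_sets lebesgue \<longrightarrow>
            (\<lambda>n. SUP I\<in>unit_subintervals.
                    \<bar>measure (isi_distribution (firing_map (fs n))) I -
                     measure (isi_distribution (firing_map f)) I\<bar>) \<longlonglongrightarrow> 0)"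
proof -
  have pi_fs: "perfect_integrator (fs n)" for n
    using assms(1,3,5) by unfold_locales auto
  interpret f: perfect_integrator f
    using assms(2,4,6) by unfold_locales auto
  have pi_f: "perfect_integrator f" ..
  let ?c = perfect_integrator.charge
  have lim: "uniform_limit {0..1} fs f sequentially"
    by (rule assms(7)) simp
  have dens_lim: "uniform_limit {0..1} (\<lambda>n t. fs n t / ?c (fs n)) (\<lambda>t. f t / f.charge) sequentially"
    by (rule density_uniform_limit[OF pi_fs pi_f lim])
  have dens: "has_continuous_density (invariant_measure (firing_map h)) (\<lambda>t. h t / ?c h)"
    if "perfect_integrator h" "rotation_number (firing_map h) \<notin> \<rat>" for h
    using perfect_integrator.phase_measure_density[OF that(1)]
      perfect_integrator.invariant_measure_eq[OF that] by simp
  let ?D = "\<lambda>n I. \<bar>measure (isi_distribution (firing_map (fs n))) I -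
    measure (isi_distribution (firing_map f)) I\<bar>"
  have isi: "(\<lambda>n. SUP I\<in>unit_subintervals. ?D n I) \<longlonglongrightarrow> 0"
    if crit: "critical_set f.\<Psi> \<in> null_sets lebesgue"
    unfolding tendsto_iff
  proof (intro allI impI)
    fix r :: real assume "r > 0"
    \<comment> \<open>One share of \<open>r / 4\<close> goes to the change of density and one to
      each endpoint strip; the total \<open>3 * r / 4\<close> stays strictly below
      \<open>r\<close>.\<close>
    obtain \<delta> where \<delta>: "\<delta> > 0" "\<And>y. y \<in> {0..1} \<Longrightarrow>
        measure f.phase_measure {t \<in> {0..1}. \<bar>f.\<Psi> t - y\<bar> \<le> \<delta>} < r / 4"
      using f.displacement_concentration[OF assms(9) crit, of "r / 4"] \<open>r > 0\<close> by auto
    \<comment> \<open>Half of a lower bound for \<open>f\<close>, so that every \<open>fs n\<close>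
      within \<open>m\<close> of \<open>f\<close> is still at least \<open>m\<close>.\<close>
    obtain m where m: "m > 0" "\<And>x. 2 * m \<le> f x"
      using f.exists_lower_bound by (metis field_sum_of_halves half_gt_zero mult_2)
    have "\<forall>\<^sub>F n in sequentially. \<forall>x\<in>{0..1}. dist (fs n x) (f x) < min m (m\<^sup>2 * \<delta>)"
      by (rule uniform_limitD[OF lim]) (use m \<delta> in simp)
    moreover have "\<forall>\<^sub>F n in sequentially. \<forall>t\<in>{0..1}. dist (fs n t / ?c (fs n)) (f t / f.charge) < r / 4"
      by (rule uniform_limitD[OF dens_lim]) (use \<open>r > 0\<close> in simp)
    ultimately show "\<forall>\<^sub>F n in sequentially. dist (SUP I\<in>unit_subintervals. ?D n I) 0 < r"
    proof eventually_elim
      case (elim n)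
      \<comment> \<open>Periodicity of both functions carries the estimate from the unit interval to
        the whole line, as \<open>firing_map_close\<close> demands.\<close>
      have close: "\<bar>fs n x - f x\<bar> < min m (m\<^sup>2 * \<delta>)" for x
        using elim(1)[rule_format, of "frac x"] frac_lt_1[of x]
        by (simp add: dist_real_def f.f_frac perfect_integrator.f_frac[OF pi_fs])
      have "m \<le> fs n x" "m \<le> f x" for x
        using close[of x] m(1) m(2)[of x] by linarith+
      then have fire: "\<bar>firing_map (fs n) t - firing_map f t\<bar> \<le> \<delta>" for t
        using m(1) close by (intro firing_map_close[OF pi_fs pi_f]) (auto simp: less_imp_le)
      have D: "?D n I \<le> r / 4 + 2 * (r / 4)" if "I \<in> unit_subintervals" for I
        by (rule isi_close[OF pi_fs pi_f assms(8,9) _ fire _ that])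
          (use elim(2) \<delta>(2) in \<open>auto simp: dist_real_def less_imp_le\<close>)
      have empty: "{} \<in> unit_subintervals"
        by (simp add: unit_subintervals_def)
      have "(SUP I\<in>unit_subintervals. ?D n I) \<le> r / 4 + 2 * (r / 4)"
        using empty D by (intro cSUP_least) auto
      \<comment> \<open>The empty interval contributes \<open>0\<close>, which bounds the supremum
        from below.\<close>
      moreover have "?D n {} \<le> (SUP I\<in>unit_subintervals. ?D n I)"
        using empty D by (intro cSUP_upper bdd_aboveI2)
      ultimately show ?case
        using \<open>r > 0\<close> by (simp add: dist_real_def)
    qed
  qed
  show ?thesis
  proof (intro conjI impI exI allI)
    show "has_continuous_density (invariant_measure (firing_map (fs n))) (\<lambda>t. fs n t / ?c (fs n))" for n
      by (rule dens[OF pi_fs assms(8)])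
    show "has_continuous_density (invariant_measure f.\<Phi>) (\<lambda>t. f t / f.charge)"
      by (rule dens[OF pi_f assms(9)])
  qed (rule dens_lim f.critical_set_eq isi; assumption?)+
qed

end
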